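(* Let $k$ be a positive integer, let $M_1=(E,\mathcal{I}_1)$ be a laminar matroid such that $E\in\mathcal{I}_1^k$, and let $M_2=(E,\mathcal{I}_2)$ be a matroid on the same ground set $E$ with rank function $r_2$ such that $|E|=k\cdot r_2(E)$ and no element of $E$ is $(k+1)$-spanned in $M_2$. Then there exists a partition $\{X_1,X_2,\dots,X_k\}$ of $E$ such that $X_j\in\mathcal{I}_1\cap\mathcal{I}_2$ for each $j=1,2,\dots,k$.
   Context: $E$ is a finite set; a matroid $(E,\mathcal{I})$ is given by its family $\mathcal{I}\subseteq 2^E$ of independent sets. A partition of $E$ is a family of pairwise disjoint subsets of $E$ with union $E$; empty members are allowed. For a matroid $(E,\mathcal{I})$ and a positive integer $k$, $\mathcal{I}^k$ is the family of all $X\subseteq E$ that can be partitioned into $k$ sets in $\mathcal{I}$. Laminar matroid: a family $\mathcal{A}\subseteq 2^E$ is laminar if for all $A_1,A_2\in\mathcal{A}$ we have $A_1\subseteq A_2$, $A_2\subseteq A_1$, or $A_1\cap A_2=\emptyset$. Given a laminar family $\mathcal{A}$ and $q:\mathcal{A}\to\mathbf{Z}_{\geq 0}$, the pair $(E,\mathcal{I})$ with $\mathcal{I}=\{X\subseteq E\mid |X\cap A|\le q(A)\ \text{for all } A\in\mathcal{A}\}$ is a matroid; a matroid arising in this way is called laminar. Spanning: in a matroid with rank function $r$, a set $X\subseteq E$ spans $e\in E$ if $r(X\cup\{e\})=r(X)$. For a positive integer $m$, an element $e$ is $m$-spanned if there exist $m$ pairwise disjoint subsets $S_1,\dots,S_m$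 of $E$ each spanning $e$ (the trivial spanning set $\{e\}$ may be one of them; the $S_i$ form an indexed family, so empty sets are allowed and may be repeated, which matters only when $e$ is a loop). *)

theory Defs
  imports "HOL-Library.Disjoint_Sets"
begin

locale matroid =
  fixes E :: "'a set" and \<I> :: "'a set set"
  assumes finite_ground: "finite E"
    and indep_subset_ground: "X \<in> \<I> \<Longrightarrow> X \<subseteq> E"
    and empty_indep: "{} \<in> \<I>"
    and indep_subset: "X \<in> \<I> \<Longrightarrow> Y \<subseteq> X \<Longrightarrow> Y \<in> \<I>"
    and augment: "X \<in> \<I> \<Longrightarrow> Y \<in> \<I> \<Longrightarrow> card X < card Y \<Longrightarrow> \<exists>y \<in> Y - X. insert y X \<in> \<I>"

text \<open>The maximum below is meaningful for the independent sets of a matroid: then the set of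
  cardinalities is finite and contains 0.\<close>

definition matroid_rank :: "'a set set \<Rightarrow> 'a set \<Rightarrow> nat" where
  "matroid_rank \<I> X = Max (card ` {Y \<in> \<I>. Y \<subseteq> X})"

text \<open>Partitions are indexed families \<open>P 1, \<dots>, P k\<close>, so that members may be empty, and the empty
  set may occur several times.\<close>

definition partition_into :: "nat \<Rightarrow> 'a set \<Rightarrow> (nat \<Rightarrow> 'a set) \<Rightarrow> bool" where
  "partition_into k X P \<longleftrightarrow> disjoint_family_on P {1..k} \<and> (\<Union>j\<in>{1..k}. P j) = X"

definition union_power :: "'a set \<Rightarrow> 'a set set \<Rightarrow> nat \<Rightarrow> 'a set set" where
  "union_power E \<I> k = {X. X \<subseteq> E \<and> (\<exists>P. partition_into k X P \<and> (\<forall>j\<in>{1..k}. P j \<in> \<I>))}"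

definition laminar_family :: "'a set set \<Rightarrow> bool" where
  "laminar_family \<A> \<longleftrightarrow>
     (\<forall>A\<^sub>1\<in>\<A>. \<forall>A\<^sub>2\<in>\<A>. A\<^sub>1 \<subseteq> A\<^sub>2 \<or> A\<^sub>2 \<subseteq> A\<^sub>1 \<or> A\<^sub>1 \<inter> A\<^sub>2 = {})"

definition laminar_matroid :: "'a set \<Rightarrow> 'a set set \<Rightarrow> bool" where
  "laminar_matroid E \<I> \<longleftrightarrow> matroid E \<I> \<and>
     (\<exists>\<A> (q :: 'a set \<Rightarrow> nat). \<A> \<subseteq> Pow E \<and> laminar_family \<A> \<and>
        \<I> = {X. X \<subseteq> E \<and> (\<forall>A\<in>\<A>. card (X \<inter> A) \<le> q A)})"

definition spans :: "'a set set \<Rightarrow> 'a set \<Rightarrow> 'a \<Rightarrow> bool" where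
  "spans \<I> X e \<longleftrightarrow> matroid_rank \<I> (X \<union> {e}) = matroid_rank \<I> X"

definition multi_spanned :: "'a set \<Rightarrow> 'a set set \<Rightarrow> nat \<Rightarrow> 'a \<Rightarrow> bool" where
  "multi_spanned E \<I> m e \<longleftrightarrow>
     (\<exists>S :: nat \<Rightarrow> 'a set. disjoint_family_on S {1..m} \<and>
        (\<forall>i\<in>{1..m}. S i \<subseteq> E \<and> spans \<I> (S i) e))"

end

theory Submission
  imports Defs
begin

text \<open>
  The members of the partition are split off one at a time. Suppose that no element of \<open>D\<close> is
  \<open>(k + 1)\<close>-spanned within \<open>D\<close> and that \<open>|D| = k r\<^sub>2(D)\<close>. A base \<open>B\<close> of \<open>D\<close> in \<open>M\<^sub>2\<close> spans all of
  \<open>D\<close>, so it can be added to any family of spanning sets found in \<open>D - B\<close>: no element of \<open>D - B\<close>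
  is \<open>k\<close>-spanned within \<open>D - B\<close> (\<open>multi_spanned_remove_base\<close>). Hence every base may be removed
  without destroying the hypothesis on \<open>M\<^sub>2\<close>, and one only has to choose it so that \<open>B \<in> \<I>\<^sub>1\<close>
  and the laminar bounds \<open>|D \<inter> A| \<le> k q(A)\<close> turn into
  \<open>|(D - B) \<inter> A| \<le> (k - 1) q(A)\<close>. Both hold if \<open>|B \<inter> A|\<close> is \<open>|D \<inter> A| / k\<close>, rounded up or down,
  for each \<open>A\<close> in the laminar family (\<open>balanced_bounds\<close>).

  It remains to find such a balanced base. Removing bases greedily also shows
  \<open>|X| \<le> k r\<^sub>2(X)\<close> for all \<open>X \<subseteq> D\<close> (\<open>card_le_mult_rank\<close>); that is, the vector with all entries
  \<open>1/k\<close> lies in the base polytope of \<open>M\<^sub>2\<close> restricted to \<open>D\<close>, and it is balanced. A balanced base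
  is an integral version of this vector. To obtain it, give the elements weights \<open>w\<close> with
  \<open>w(X) \<le> k r\<^sub>2(X)\<close>, initially \<open>1\<close>, and use induction on the size of the laminar family
  (\<open>balanced_base_weighted\<close>). Take a minimal member \<open>A\<close> and write \<open>w(A) = k m + s\<close> with
  \<open>s < k\<close>. A balanced base has \<open>m\<close> elements in \<open>A\<close>, and possibly one more if \<open>s > 0\<close>. The other
  members of the family contain \<open>A\<close> or are disjoint from it, so they do not see which elements of
  \<open>A\<close> these are. So \<open>A\<close> may be replaced by points in general position on the flat that it spans:
  \<open>m\<close> of them are contracted, and one more, of weight \<open>s\<close>, stays if \<open>s > 0\<close>. The inequality between
  weight and rank is preserved (\<open>weight_bound_general_position\<close>), and the family has become smaller.
\<close>

section \<open>Bases of matroids\<close>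

lemma (in matroid) indep_finite: "X \<in> \<I> \<Longrightarrow> finite X"
  using indep_subset_ground finite_ground finite_subset by blast

lemma (in matroid) augment_to_card:
  assumes "X \<in> \<I>" "Y \<in> \<I>" "card X \<le> card Y"
  shows "\<exists>T\<in>\<I>. X \<subseteq> T \<and> T \<subseteq> X \<union> Y \<and> card T = card Y"
  using assms
proof (induction "card Y - card X" arbitrary: X)
  case 0
  then show ?case by auto
next
  case (Suc n)
  then obtain y where y: "y \<in> Y - X" "insert y X \<in> \<I>"
    using augment[of X Y] by (metis zero_less_Suc zero_less_diff)
  have c: "card (insert y X) = Suc (card X)"
    using y Suc.prems(1) indep_finite by simp
  have "\<exists>T\<in>\<I>. insert y X \<subseteq> T \<and> T \<subseteq> insert y X \<union> Y \<and> card T = card Y"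
  proof (rule Suc.hyps(1))
    show "n = card Y - card (insert y X)" "card (insert y X) \<le> card Y"
      using c Suc.hyps(2) by linarith+
  qed fact+
  then show ?case using y by blast
qed

lemma (in matroid) shrink_to_card:
  assumes "T \<in> \<I>" "n \<le> card T"
  shows "\<exists>S\<in>\<I>. S \<subseteq> T \<and> card S = n"
  using assms indep_subset obtain_subset_with_card_n by metis

lemma (in matroid) matroid_restrict:
  assumes "D \<subseteq> E"
  shows "matroid D {Y \<in> \<I>. Y \<subseteq> D}"
proof
  show "finite D" using assms finite_ground finite_subset by blast
next
  fix X Y assume "X \<in> {Y \<in> \<I>. Y \<subseteq> D}" "Y \<subseteq> X"
  then show "Y \<in> {Y \<in> \<I>. Y \<subseteq> D}" using indep_subset by blast
next
  fix X Y assume *: "X \<in> {Y \<in> \<I>. Y \<subseteq> D}" "Y \<in> {Y \<in> \<I>. Y \<subseteq> D}" "card X < card Y"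
  then obtain y where "y \<in> Y - X" "insert y X \<in> \<I>"
    using augment[of X Y] by auto
  then show "\<exists>y\<in>Y - X. insert y X \<in> {Y \<in> \<I>. Y \<subseteq> D}" using * by blast
qed (use empty_indep in auto)

lemma (in matroid) finite_rank_set: "finite (card ` {Y \<in> \<I>. Y \<subseteq> X})"
proof -
  have "{Y \<in> \<I>. Y \<subseteq> X} \<subseteq> Pow E" using indep_subset_ground by blast
  then show ?thesis using finite_ground by (meson finite_Pow_iff finite_imageI finite_subset)
qed

lemma (in matroid) card_le_rank:
  assumes "Y \<in> \<I>" "Y \<subseteq> X"
  shows "card Y \<le> matroid_rank \<I> X"
  unfolding matroid_rank_def using assms finite_rank_set by (intro Max_ge) auto

lemma (in matroid) obtain_base:
  obtains Y where "Y \<in> \<I>" "Y \<subseteq> X" "card Y = matroid_rank \<I> X"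
proof -
  have "Max (card ` {Y \<in> \<I>. Y \<subseteq> X}) \<in> card ` {Y \<in> \<I>. Y \<subseteq> X}"
    using empty_indep by (intro Max_in finite_rank_set) auto
  then show thesis using that unfolding matroid_rank_def by auto
qed

lemma (in matroid) rank_mono: "X \<subseteq> Y \<Longrightarrow> matroid_rank \<I> X \<le> matroid_rank \<I> Y"
  using obtain_base[of X] card_le_rank[of _ Y] by (metis subset_trans)

lemma (in matroid) base_spans:
  assumes "B \<in> \<I>" "B \<subseteq> X" "card B = matroid_rank \<I> X" "e \<in> X"
  shows "spans \<I> B e"
proof -
  have "matroid_rank \<I> (B \<union> {e}) \<le> matroid_rank \<I> X"
    using assms by (intro rank_mono) auto
  moreover have "card B \<le> matroid_rank \<I> B" using card_le_rank[OF assms(1)] by blast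
  moreover have "matroid_rank \<I> B \<le> matroid_rank \<I> (B \<union> {e})" by (intro rank_mono) auto
  ultimately show ?thesis unfolding spans_def using assms(3) by linarith
qed


section \<open>Multiply spanned elements\<close>

text \<open>A base of \<open>X\<close> spans every element of \<open>X\<close> and is disjoint from all subsets of \<open>X - B\<close>, so it
  serves as an additional spanning set.\<close>

lemma (in matroid) multi_spanned_remove_base:
  assumes "B \<in> \<I>" "B \<subseteq> X" "card B = matroid_rank \<I> X"
    and "e \<in> X - B" "multi_spanned (X - B) \<I> n e"
  shows "multi_spanned X \<I> (Suc n) e"
proof -
  obtain S where S: "disjoint_family_on S {1..n}" "\<forall>i\<in>{1..n}. S i \<subseteq> X - B \<and> spans \<I> (S i) e"
    using assms(5) unfolding multi_spanned_def by blast
  have sp: "spans \<I> B e" using assms base_spans by blast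
  have "disjoint_family_on (S(Suc n := B)) {1..Suc n}"
    unfolding disjoint_family_on_def
  proof (intro ballI impI)
    fix i j assume ij: "i \<in> {1..Suc n}" "j \<in> {1..Suc n}" "i \<noteq> j"
    then consider "i = Suc n" "j \<in> {1..n}" | "j = Suc n" "i \<in> {1..n}" | "i \<in> {1..n}" "j \<in> {1..n}"
      by fastforce
    then show "(S(Suc n := B)) i \<inter> (S(Suc n := B)) j = {}"
    proof cases
      case 3
      then show ?thesis using S(1) ij(3) unfolding disjoint_family_on_def by auto
    qed (use S(2) in \<open>auto; fastforce\<close>)+
  qed
  moreover have "\<forall>i\<in>{1..Suc n}. (S(Suc n := B)) i \<subseteq> X \<and> spans \<I> ((S(Suc n := B)) i) e"
    using S(2) sp assms(2) by (auto simp: le_Suc_eq)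
  ultimately show ?thesis unfolding multi_spanned_def by blast
qed

text \<open>The trivial spanning set \<open>{e}\<close>.\<close>

lemma multi_spanned_one: "e \<in> X \<Longrightarrow> multi_spanned X \<I> 1 e"
  unfolding multi_spanned_def spans_def disjoint_family_on_def
  by (intro exI[of _ "\<lambda>_. {e}"]) auto

lemma multi_spanned_mono: "X \<subseteq> Y \<Longrightarrow> multi_spanned X \<I> n e \<Longrightarrow> multi_spanned Y \<I> n e"
  unfolding multi_spanned_def by (meson subset_trans)

text \<open>Removing a base from \<open>X\<close> lowers the multiplicity with which the remaining elements can be spanned;
  after \<open>k\<close> rounds an element that is still left would be spanned by the \<open>k\<close> removed bases and by
  itself. So \<open>X\<close> is exhausted by \<open>k\<close> sets of size at most the rank of \<open>X\<close>.\<close>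

lemma (in matroid) card_le_mult_rank:
  assumes "X \<subseteq> E" "\<forall>e\<in>X. \<not> multi_spanned X \<I> (k + 1) e"
  shows "card X \<le> k * matroid_rank \<I> X"
  using assms
proof (induction k arbitrary: X)
  case 0
  then have "X = {}" using multi_spanned_one by fastforce
  then show ?case by simp
next
  case (Suc k)
  obtain B where B: "B \<in> \<I>" "B \<subseteq> X" "card B = matroid_rank \<I> X" using obtain_base by blast
  have "\<forall>e\<in>X - B. \<not> multi_spanned (X - B) \<I> (k + 1) e"
    using Suc.prems(2) multi_spanned_remove_base[OF B] by auto
  then have "card (X - B) \<le> k * matroid_rank \<I> (X - B)"
    using Suc.IH[of "X - B"] Suc.prems(1) by blast
  also have "\<dots> \<le> k * matroid_rank \<I> X" by (intro mult_le_mono2 rank_mono) auto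
  finally have "card (X - B) \<le> k * matroid_rank \<I> X" .
  moreover have "card X \<le> card (X - B) + card B"
    using B(2) Suc.prems(1) finite_ground finite_subset
    by (metis add.commute card_Diff_subset le_add_diff_inverse card_mono order_refl)
  ultimately show ?case using B(3) by simp
qed


section \<open>Replacing a set by points in general position\<close>

text \<open>In matroid terms: extend the matroid by \<open>m + |Z|\<close> points placed freely on the flat spanned by \<open>A\<close>,
  contract \<open>m\<close> of them and delete \<open>A\<close>. A set containing \<open>p\<close> free points is independent in the
  extension iff these points can be exchanged for \<open>p\<close> elements of \<open>A\<close>, which is how independence is
  expressed here. The surviving free points are named by elements of \<open>A\<close>, so that the type of
  elements does not change; this is why \<open>Z \<subseteq> A\<close> below.\<close>

definition general_position :: "'a set set \<Rightarrow> 'a set \<Rightarrow> 'a set \<Rightarrow> nat \<Rightarrow> 'a set \<Rightarrow> 'a set set" where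
  "general_position \<I> E A m Z =
     {X. X \<subseteq> (E - A) \<union> Z \<and> (\<exists>T\<in>\<I>. T - A = X - A \<and> card (T \<inter> A) = m + card (X \<inter> Z))}"

lemma general_positionI:
  assumes "T \<in> \<I>" "T - A = X - A" "card (T \<inter> A) = m + card (X \<inter> Z)" "X \<subseteq> (E - A) \<union> Z"
  shows "X \<in> general_position \<I> E A m Z"
  using assms unfolding general_position_def by blast

text \<open>For augmentation, lift \<open>X\<close> and \<open>Y\<close> to independent sets \<open>T\<close> and \<open>U\<close> of the original matroid and
  augment \<open>T\<close> from \<open>U\<close>. An element outside \<open>A\<close> augments \<open>X\<close> directly. An element of \<open>A\<close> leaves room for
  another free point if \<open>Y\<close> has one to offer; otherwise it can be exchanged for an element of
  \<open>T \<inter> A\<close> outside \<open>U\<close>, which brings \<open>T\<close> closer to \<open>U\<close>. Choosing \<open>T\<close> with the largest possible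
  intersection with \<open>U\<close> excludes this last case.\<close>

lemma (in matroid) matroid_general_position:
  assumes "Z \<subseteq> A" "A \<subseteq> E" and W: "W \<in> \<I>" "W \<subseteq> A" "card W = m"
  shows "matroid ((E - A) \<union> Z) (general_position \<I> E A m Z)"
proof
  show "finite (E - A \<union> Z)" using assms(1,2) finite_ground by (meson finite_Diff finite_UnI finite_subset)
next
  fix X assume "X \<in> general_position \<I> E A m Z"
  then show "X \<subseteq> E - A \<union> Z" unfolding general_position_def by blast
next
  show "{} \<in> general_position \<I> E A m Z"
    by (rule general_positionI[OF W(1)]) (use W in \<open>auto simp: Int_absorb2\<close>)
next
  fix X Y assume X: "X \<in> general_position \<I> E A m Z" and Y: "Y \<subseteq> X"
  obtain T where T: "T \<in> \<I>" "T - A = X - A" "card (T \<inter> A) = m + card (X \<inter> Z)"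
    and XE: "X \<subseteq> (E - A) \<union> Z"
    using X unfolding general_position_def by blast
  have fX: "finite X" using XE assms(1,2) finite_ground by (meson finite_Diff finite_UnI finite_subset)
  have "m + card (Y \<inter> Z) \<le> card (T \<inter> A)"
    using T(3) card_mono[of "X \<inter> Z" "Y \<inter> Z"] Y fX by auto
  then obtain S where S: "S \<subseteq> T \<inter> A" "card S = m + card (Y \<inter> Z)"
    using obtain_subset_with_card_n by metis
  have "S \<union> (Y - A) \<in> \<I>" by (rule indep_subset[OF T(1)]) (use S(1) T(2) Y in blast)
  moreover have "(S \<union> (Y - A)) - A = Y - A" "(S \<union> (Y - A)) \<inter> A = S" using S(1) by auto
  ultimately show "Y \<in> general_position \<I> E A m Z"
    using S(2) XE Y by (intro general_positionI[of "S \<union> (Y - A)"]) auto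
next
  fix X Y assume X: "X \<in> general_position \<I> E A m Z" and Y: "Y \<in> general_position \<I> E A m Z"
    and lt: "card X < card Y"
  have split: "card (V - A) + card (V \<inter> Z) = card V" if "V \<subseteq> (E - A) \<union> Z" for V
  proof -
    have "finite V" using that assms(1,2) finite_ground by (meson finite_Diff finite_UnI finite_subset)
    moreover have "V \<inter> Z = V \<inter> A" using that assms by auto
    ultimately show ?thesis using card_Int_Diff[of V A] by simp
  qed
  have XE: "X \<subseteq> (E - A) \<union> Z" and YE: "Y \<subseteq> (E - A) \<union> Z"
    using X Y unfolding general_position_def by auto
  obtain U where U: "U \<in> \<I>" "U - A = Y - A" "card (U \<inter> A) = m + card (Y \<inter> Z)"
    using Y unfolding general_position_def by blast
  define R where "R = {T \<in> \<I>. T - A = X - A \<and> card (T \<inter> A) = m + card (X \<inter> Z)}"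
  have "\<exists>T. T \<in> R" using X unfolding R_def general_position_def by blast
  moreover have "\<forall>T. T \<in> R \<longrightarrow> card (T \<inter> U) < Suc (card U)"
    using U(1) indep_finite by (simp add: card_mono less_Suc_eq_le)
  ultimately obtain T where TR: "T \<in> R" and Tmax: "\<And>T'. T' \<in> R \<Longrightarrow> card (T' \<inter> U) \<le> card (T \<inter> U)"
    using ex_has_greatest_nat[of "\<lambda>T. T \<in> R" _ "\<lambda>T. card (T \<inter> U)" "Suc (card U)"]
    by (meson less_imp_le)
  have T: "T \<in> \<I>" "T - A = X - A" "card (T \<inter> A) = m + card (X \<inter> Z)"
    using TR unfolding R_def by auto
  have fT: "finite T" and fU: "finite U" using T U indep_finite by auto
  have "card T = m + card X"
    using card_Int_Diff[OF fT, of A] T split[OF XE] by simp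
  moreover have "card U = m + card Y"
    using card_Int_Diff[OF fU, of A] U split[OF YE] by simp
  ultimately obtain y where y: "y \<in> U - T" "insert y T \<in> \<I>"
    using augment[OF T(1) U(1)] lt by auto
  show "\<exists>y\<in>Y - X. insert y X \<in> general_position \<I> E A m Z"
  proof (cases "y \<in> A")
    case False
    then have "y \<in> Y - X" using y U(2) T(2) by blast
    moreover have "insert y T - A = insert y X - A" "insert y T \<inter> A = T \<inter> A"
      "insert y X \<inter> Z = X \<inter> Z" "insert y X \<subseteq> (E - A) \<union> Z"
      using False T(2) XE YE calculation assms(1) by auto
    ultimately show ?thesis
      using y(2) T(3) general_positionI[of "insert y T" \<I> A "insert y X" m Z E] by auto
  next
    case True
    have cA: "card (insert y T \<inter> A) = Suc (card (T \<inter> A))" using True y(1) fT by simp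
    show ?thesis
    proof (cases "card (X \<inter> Z) < card (Y \<inter> Z)")
      case less: True
      have "finite (X \<inter> Z)"
        using finite_ground assms finite_subset by (metis finite_Int)
      then obtain z where z: "z \<in> Y \<inter> Z" "z \<notin> X \<inter> Z"
        using less by (metis card_mono linorder_not_less subsetI)
      have "card (insert z X \<inter> Z) = Suc (card (X \<inter> Z))"
        using z \<open>finite (X \<inter> Z)\<close> by simp
      moreover have "insert y T - A = insert z X - A" using True z T(2) assms(1) by auto
      moreover have "insert z X \<subseteq> (E - A) \<union> Z" using z XE by auto
      ultimately have "insert z X \<in> general_position \<I> E A m Z"
        using y(2) T(3) cA by (intro general_positionI[of "insert y T"]) auto
      then show ?thesis using z by blast
    next
      case False
      have "\<exists>x. x \<in> T \<inter> A \<and> x \<notin> U"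
      proof (rule ccontr)
        assume "\<not> ?thesis"
        then have "insert y T \<inter> A \<subseteq> U \<inter> A" using y by auto
        then have "Suc (card (T \<inter> A)) \<le> card (U \<inter> A)"
          using cA fU by (metis card_mono finite_Int)
        then show False using False T(3) U(3) by linarith
      qed
      then obtain x where x: "x \<in> T" "x \<in> A" "x \<notin> U" by blast
      define T' where "T' = insert y T - {x}"
      have "T' \<in> \<I>" unfolding T'_def by (rule indep_subset[OF y(2)]) blast
      moreover have "T' - A = X - A" using T(2) True x T'_def by auto
      moreover have "card (T' \<inter> A) = card (T \<inter> A)"
      proof -
        have "T' \<inter> A = (insert y T \<inter> A) - {x}" unfolding T'_def by auto
        then show ?thesis using cA x fT by simp
      qed
      ultimately have "T' \<in> R" using T(3) unfolding R_def by simp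
      moreover have "T' \<inter> U = insert y (T \<inter> U)" using x y unfolding T'_def by auto
      then have "card (T' \<inter> U) = Suc (card (T \<inter> U))" using y fT by simp
      ultimately show ?thesis using Tmax by fastforce
    qed
  qed
qed


section \<open>Bases that meet a laminar family evenly\<close>

lemma laminar_subset: "laminar_family \<A> \<Longrightarrow> \<B> \<subseteq> \<A> \<Longrightarrow> laminar_family \<B>"
  unfolding laminar_family_def by blast

text \<open>Two members containing \<open>A\<close> are comparable unless \<open>A = {}\<close>, so inserting the same set \<open>Z\<close> into each
  of them creates no crossing pair.\<close>

lemma laminar_replace:
  assumes lam: "laminar_family \<A>" and "Z \<subseteq> A"
  shows "laminar_family ((\<lambda>C. (C - A) \<union> (if A \<subseteq> C then Z else {})) ` \<A>)"
proof -
  have "(C - A) \<union> (if A \<subseteq> C then Z else {}) \<subseteq> (D - A) \<union> (if A \<subseteq> D then Z else {}) \<or>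
      (D - A) \<union> (if A \<subseteq> D then Z else {}) \<subseteq> (C - A) \<union> (if A \<subseteq> C then Z else {}) \<or>
      ((C - A) \<union> (if A \<subseteq> C then Z else {})) \<inter> ((D - A) \<union> (if A \<subseteq> D then Z else {})) = {}"
    if "C \<in> \<A>" "D \<in> \<A>" for C D
  proof -
    have "C \<subseteq> D \<or> D \<subseteq> C \<or> C \<inter> D = {}" using lam that unfolding laminar_family_def by blast
    then show ?thesis
    proof (elim disjE)
      assume "C \<subseteq> D"
      then show ?thesis by (intro disjI1) auto
    next
      assume "D \<subseteq> C"
      then show ?thesis by (intro disjI2 disjI1) auto
    next
      assume "C \<inter> D = {}"
      show ?thesis
      proof (cases "A = {}")
        case False
        then have "\<not> (A \<subseteq> C \<and> A \<subseteq> D)" using \<open>C \<inter> D = {}\<close> by blast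
        then show ?thesis using \<open>C \<inter> D = {}\<close> \<open>Z \<subseteq> A\<close> by (intro disjI2) auto
      qed (use \<open>Z \<subseteq> A\<close> \<open>C \<inter> D = {}\<close> in auto)
    qed
  qed
  then show ?thesis unfolding laminar_family_def by blast
qed

text \<open>Let \<open>X\<^sub>0 = X - A\<close>, let \<open>p\<close> be the number of free points in \<open>X\<close> and \<open>m = w(A) div k\<close>. The rank of
  \<open>X\<close> after the replacement is the minimum of \<open>r(X\<^sub>0) + p\<close> and \<open>r(X\<^sub>0 \<union> A) - m\<close>: free points raise
  the rank one by one until the flat spanned by \<open>A\<close> is absorbed. The first value suffices because
  a free point has weight less than \<open>k\<close>; the second because \<open>w(X\<^sub>0 \<union> A)\<close> is at most
  \<open>k r(X\<^sub>0 \<union> A)\<close> and \<open>w(A)\<close> exceeds the weight of \<open>Z\<close> by exactly \<open>k m\<close>.\<close>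

lemma (in matroid) weight_bound_general_position:
  fixes w :: "'a \<Rightarrow> nat"
  assumes bound: "\<And>X. X \<subseteq> E \<Longrightarrow> \<exists>Y\<in>\<I>. Y \<subseteq> X \<and> sum w X \<le> k * card Y"
    and "k > 0" "A \<subseteq> E" "Z \<subseteq> A" "card Z \<le> 1"
    and wZ: "sum w' Z = sum w A mod k" and w': "\<And>x. x \<notin> A \<Longrightarrow> w' x = w x"
    and X: "X \<subseteq> (E - A) \<union> Z"
  shows "\<exists>Y\<in>general_position \<I> E A (sum w A div k) Z. Y \<subseteq> X \<and> sum w' X \<le> k * card Y"
proof -
  define m where "m = sum w A div k"
  define s where "s = sum w A mod k"
  have wA: "sum w A = k * m + s" and s: "s < k" unfolding m_def s_def using \<open>k > 0\<close> by auto
  have fA: "finite A" and fZ: "finite Z" and fX: "finite X"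
    using assms(3,4) X finite_ground by (meson finite_Diff finite_UnI finite_subset)+
  define X0 where "X0 = X - A"
  have X0: "X0 \<subseteq> E" "X0 \<inter> A = {}" "finite X0" using X fX assms(4) unfolding X0_def by auto
  have Xeq: "X = X0 \<union> (X \<inter> Z)" using X unfolding X0_def by auto
  have "sum w' X = sum w' X0 + sum w' (X \<inter> Z)"
    using X0 fX assms(4) by (subst Xeq, intro sum.union_disjoint) auto
  also have "sum w' X0 = sum w X0" using X0(2) w' by (intro sum.cong) auto
  finally have wX: "sum w' X = sum w X0 + sum w' (X \<inter> Z)" .
  have wXZ: "sum w' (X \<inter> Z) \<le> s" "X \<inter> Z = {} \<Longrightarrow> sum w' (X \<inter> Z) = 0"
    using fZ wZ unfolding s_def by (auto intro: sum_mono2 simp flip: wZ)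
  have cXZ: "card (X \<inter> Z) \<le> 1" using assms(5) fZ card_mono[of Z "X \<inter> Z"] by auto
  have wu: "sum w (X0 \<union> A) = sum w X0 + sum w A" using X0 fA by (intro sum.union_disjoint) auto

  \<comment> \<open>One independent set \<open>T\<close> that bounds the weight of \<open>X0 \<union> A\<close> and, with its part outside \<open>A\<close>,
    also that of \<open>X0\<close>.\<close>
  obtain Y where Y: "Y \<in> \<I>" "Y \<subseteq> X0" "sum w X0 \<le> k * card Y" using bound X0(1) by blast
  obtain T0 where T0: "T0 \<in> \<I>" "T0 \<subseteq> X0 \<union> A" "sum w (X0 \<union> A) \<le> k * card T0"
    using bound[of "X0 \<union> A"] X0(1) assms(3) by blast
  obtain T where T: "T \<in> \<I>" "Y \<subseteq> T" "T \<subseteq> X0 \<union> A" "card T0 \<le> card T"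
  proof (cases "card Y \<le> card T0")
    case True
    then show thesis using augment_to_card[OF Y(1) T0(1)] that Y(2) T0(2) by fastforce
  qed (use that Y in fastforce)
  have fT: "finite T" using T(1) indep_finite by blast
  have wT: "sum w X0 + (k * m + s) \<le> k * card T"
    using T0(3) T(4) wu wA by (metis mult_le_mono2 order_trans)
  have "Y \<subseteq> T - A" using T(2) Y(2) X0(2) by blast
  then have "card Y \<le> card (T - A)" using fT by (simp add: card_mono)
  then have wTA: "sum w X0 \<le> k * card (T - A)" using Y(3) by (meson mult_le_mono2 order_trans)
  have TA: "T - A \<subseteq> X0" using T(3) by blast
  show ?thesis unfolding m_def[symmetric]
  proof (cases "m + card (X \<inter> Z) \<le> card (T \<inter> A)")
    case True
    \<comment> \<open>\<open>T\<close> has enough elements in \<open>A\<close> to represent the free points, so the whole of \<open>T - A\<close> can be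
      kept.\<close>
    then obtain S where S: "S \<subseteq> T \<inter> A" "card S = m + card (X \<inter> Z)"
      using obtain_subset_with_card_n by metis
    let ?Y = "(T - A) \<union> (X \<inter> Z)"
    have "S \<union> (T - A) \<in> \<I>" by (rule indep_subset[OF T(1)]) (use S(1) in blast)
    moreover have "S \<union> (T - A) - A = ?Y - A" "(S \<union> (T - A)) \<inter> A = S" "?Y \<inter> Z = X \<inter> Z"
      using S(1) assms(4) by blast+
    moreover have "?Y \<subseteq> (E - A) \<union> Z" using TA X0 by auto
    ultimately have "?Y \<in> general_position \<I> E A m Z"
      using S(2) general_positionI[of "S \<union> (T - A)" \<I> A ?Y m Z E] by simp
    moreover have "?Y \<subseteq> X" using TA X0_def by auto
    moreover have "card ?Y = card (T - A) + card (X \<inter> Z)"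
      using fT fX assms(4) by (intro card_Un_disjoint) auto
    then have "sum w' X \<le> k * card ?Y"
    proof (cases "X \<inter> Z = {}")
      case False
      then have "card (X \<inter> Z) = 1" using cXZ fX
        by (metis card_0_eq finite_Int le_antisym less_one linorder_not_less)
      then show ?thesis using \<open>card ?Y = _\<close> wX wXZ s wTA by (simp add: algebra_simps)
    qed (use wX wXZ wTA in simp)
    ultimately show "\<exists>Y\<in>general_position \<I> E A m Z. Y \<subseteq> X \<and> sum w' X \<le> k * card Y" by blast
  next
    case False
    \<comment> \<open>\<open>T\<close> has too few elements in \<open>A\<close>: its part in \<open>A\<close> is enlarged to exactly \<open>m\<close> elements, at the
      expense of \<open>T - A\<close> but keeping the total size.\<close>
    then have tm: "card (T \<inter> A) \<le> m" using cXZ by linarith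
    obtain Am where Am: "Am \<in> \<I>" "Am \<subseteq> A" "card Am = m"
    proof -
      obtain Y where "Y \<in> \<I>" "Y \<subseteq> A" "sum w A \<le> k * card Y" using bound assms(3) by blast
      then have "k * m \<le> k * card Y" using wA by linarith
      then have "m \<le> card Y" using \<open>k > 0\<close> by simp
      then show thesis using shrink_to_card[OF \<open>Y \<in> \<I>\<close>] that \<open>Y \<subseteq> A\<close> by (meson subset_trans)
    qed
    have "T \<inter> A \<in> \<I>" by (rule indep_subset[OF T(1)]) blast
    then obtain W where W: "W \<in> \<I>" "T \<inter> A \<subseteq> W" "W \<subseteq> A" "card W = m"
      using augment_to_card[of "T \<inter> A" Am] Am tm by auto
    have "k * m \<le> k * card T" using wT by linarith
    then have "m \<le> card T" using \<open>k > 0\<close> by simp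
    then obtain D where D: "D \<in> \<I>" "W \<subseteq> D" "D \<subseteq> W \<union> T" "card D = card T"
      using augment_to_card[OF W(1) T(1)] W(4) by auto
    have DA: "D \<inter> A = W" "D - A \<subseteq> X0" using D W T by auto
    moreover have "(D - A) \<inter> Z = {}" "D - A \<subseteq> (E - A) \<union> Z" using DA X0 assms(4) by blast+
    ultimately have "D - A \<in> general_position \<I> E A m Z"
      using D(1) W(4) by (intro general_positionI[of D]) auto
    moreover have "D - A \<subseteq> X" using DA X0_def by blast
    moreover have "card D = m + card (D - A)"
      using card_Int_Diff[of D A] D(1) indep_finite DA W(4) by metis
    then have "sum w X0 + s \<le> k * card (D - A)" using wT D(4) by (simp add: algebra_simps)
    then have "sum w' X \<le> k * card (D - A)" using wX wXZ by linarith
    ultimately show "\<exists>Y\<in>general_position \<I> E A m Z. Y \<subseteq> X \<and> sum w' X \<le> k * card Y" by blast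
  qed
qed

text \<open>The two inequalities say that \<open>|B \<inter> A|\<close> is the floor or the ceiling of \<open>w(A) / k\<close>. Weights make
  the statement inductive: the free point that takes the place of a minimal \<open>A\<close> inherits the remainder
  of \<open>w(A)\<close> modulo \<open>k\<close>.\<close>

lemma balanced_base_weighted:
  fixes w :: "'a \<Rightarrow> nat"
  assumes "matroid E \<I>" "k > 0"
    and "\<And>X. X \<subseteq> E \<Longrightarrow> \<exists>Y\<in>\<I>. Y \<subseteq> X \<and> sum w X \<le> k * card Y"
    and "sum w E = k * r"
    and "laminar_family \<A>" "\<A> \<subseteq> Pow E"
  shows "\<exists>B\<in>\<I>. card B = r \<and>
    (\<forall>A\<in>\<A>. k * card (B \<inter> A) < sum w A + k \<and> sum w A < k * card (B \<inter> A) + k)"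
  using assms(1,3-6)
proof (induction "card \<A>" arbitrary: \<A> E \<I> w r rule: less_induct)
  case less
  interpret matroid E \<I> by fact
  note bound = less.prems(2)
  have fin: "finite \<A>" using less.prems(5) finite_ground finite_subset by blast
  consider "\<A> = {}" | "{} \<in> \<A>" | "\<A> \<noteq> {}" "{} \<notin> \<A>" by blast
  then show ?case
  proof cases
    case 1
    obtain Y where "Y \<in> \<I>" "sum w E \<le> k * card Y" using bound by blast
    then have "r \<le> card Y" using less.prems(3) \<open>k > 0\<close> by simp
    then show ?thesis using shrink_to_card[OF \<open>Y \<in> \<I>\<close>] 1 by auto
  next
    case 2
    have "\<exists>B\<in>\<I>. card B = r \<and>
      (\<forall>A\<in>\<A> - {{}}. k * card (B \<inter> A) < sum w A + k \<and> sum w A < k * card (B \<inter> A) + k)"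
    proof (rule less.hyps)
      show "card (\<A> - {{}}) < card \<A>" using 2 fin by (intro psubset_card_mono) auto
      show "laminar_family (\<A> - {{}})" using less.prems(4) laminar_subset by blast
    qed (use less.prems in auto)
    then show ?thesis using \<open>k > 0\<close> by fastforce
  next
    case 3
    obtain A where A: "A \<in> \<A>" "\<And>C. C \<in> \<A> \<Longrightarrow> C \<subseteq> A \<Longrightarrow> C = A"
      using finite_has_minimal[OF fin 3(1)] by metis
    have AE: "A \<subseteq> E" and "A \<noteq> {}" using A less.prems(5) 3(2) by auto
    then obtain z where z: "z \<in> A" by blast
    have fA: "finite A" using AE finite_ground finite_subset by blast
    have cases: "A \<subseteq> C \<or> C \<inter> A = {}" if "C \<in> \<A>" for C
    proof -
      have "A \<subseteq> C \<or> C \<subseteq> A \<or> A \<inter> C = {}"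
        using less.prems(4) A(1) that unfolding laminar_family_def by blast
      then show ?thesis using A(2)[OF that] by auto
    qed
    define m where "m = sum w A div k"
    define s where "s = sum w A mod k"
    have wA: "sum w A = k * m + s" and s: "s < k" unfolding m_def s_def using \<open>k > 0\<close> by auto
    \<comment> \<open>If \<open>k\<close> divides \<open>w(A)\<close> then exactly \<open>m\<close> elements of \<open>A\<close> are wanted; a free point of weight
      \<open>0\<close> would allow one more.\<close>
    define Z where "Z = (if s = 0 then {} else {z})"
    define w' where "w' = w(z := s)"
    define E' where "E' = (E - A) \<union> Z"
    define J where "J = general_position \<I> E A m Z"
    define f where "f = (\<lambda>C. (C - A) \<union> (if A \<subseteq> C then Z else {}))"
    have ZA: "Z \<subseteq> A" and cZ: "card Z \<le> 1" and wZ: "sum w' Z = s"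
      using z unfolding Z_def w'_def by auto
    have fZ: "finite Z" unfolding Z_def by simp
    have w': "w' x = w x" if "x \<notin> A" for x using that z unfolding w'_def by auto
    have sum_w': "sum w' (C - A) = sum w (C - A)" for C using w' by (intro sum.cong) auto
    have weight: "sum w C = k * m + sum w' ((C - A) \<union> Z)" if "A \<subseteq> C" "C \<subseteq> E" for C
    proof -
      have fC: "finite C" using that finite_ground finite_subset by blast
      have "sum w C = sum w (C - A) + sum w A" using that fC by (simp add: sum.subset_diff)
      moreover have "sum w' ((C - A) \<union> Z) = sum w' (C - A) + sum w' Z"
        using fC fZ ZA by (intro sum.union_disjoint) auto
      ultimately show ?thesis using wA wZ sum_w' by simp
    qed
    have rm: "m \<le> r" and wE': "sum w' E' = k * (r - m)"
    proof -
      have *: "k * r = k * m + sum w' E'"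
        using weight[OF AE] less.prems(3) unfolding E'_def by simp
      then have "k * m \<le> k * r" by linarith
      then show "m \<le> r" using \<open>k > 0\<close> by simp
      then show "sum w' E' = k * (r - m)" using * by (simp add: diff_mult_distrib2)
    qed
    obtain W where W: "W \<in> \<I>" "W \<subseteq> A" "card W = m"
    proof -
      obtain Y where "Y \<in> \<I>" "Y \<subseteq> A" "sum w A \<le> k * card Y" using bound AE by blast
      then have "k * m \<le> k * card Y" using wA by linarith
      then have "m \<le> card Y" using \<open>k > 0\<close> by simp
      then show thesis using shrink_to_card[OF \<open>Y \<in> \<I>\<close>] that \<open>Y \<subseteq> A\<close> by (meson subset_trans)
    qed
    \<comment> \<open>The map \<open>f\<close> need not be injective, but the family has lost \<open>A\<close>, so it is smaller in any case.\<close>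
    obtain B' where B': "B' \<in> J" "card B' = r - m" and B'f: "\<And>C. C \<in> f ` (\<A> - {A}) \<Longrightarrow>
        k * card (B' \<inter> C) < sum w' C + k \<and> sum w' C < k * card (B' \<inter> C) + k"
    proof -
      have "\<exists>B\<in>J. card B = r - m \<and>
        (\<forall>C\<in>f ` (\<A> - {A}). k * card (B \<inter> C) < sum w' C + k \<and> sum w' C < k * card (B \<inter> C) + k)"
      proof (rule less.hyps)
        have "card (f ` (\<A> - {A})) \<le> card (\<A> - {A})" using fin by (intro card_image_le) auto
        also have "\<dots> < card \<A>" using fin A(1) by (intro psubset_card_mono) auto
        finally show "card (f ` (\<A> - {A})) < card \<A>" .
        show "matroid E' J" unfolding E'_def J_def
          by (rule matroid_general_position[OF ZA AE W])
        show "\<exists>Y\<in>J. Y \<subseteq> X \<and> sum w' X \<le> k * card Y" if "X \<subseteq> E'" for X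
          unfolding J_def m_def
          by (rule weight_bound_general_position[OF bound])
            (use that E'_def \<open>k > 0\<close> AE ZA cZ wZ w' s_def in auto)
        show "sum w' E' = k * (r - m)" by fact
        show "laminar_family (f ` (\<A> - {A}))" unfolding f_def
          using laminar_replace[OF laminar_subset[OF less.prems(4)] ZA, of "\<A> - {A}"] by blast
        show "f ` (\<A> - {A}) \<subseteq> Pow E'" using less.prems(5) unfolding f_def E'_def
          by (auto split: if_splits)
      qed
      then show thesis using that by blast
    qed
    obtain T where T: "T \<in> \<I>" "T - A = B' - A" "card (T \<inter> A) = m + card (B' \<inter> Z)"
      and B'E: "B' \<subseteq> (E - A) \<union> Z"
      using B'(1) unfolding J_def general_position_def by blast
    have fT: "finite T" using T(1) indep_finite by blast
    have fB: "finite B'" using B'E fZ finite_ground by (meson finite_Diff finite_UnI finite_subset)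
    have card_split: "card (T \<inter> C) = m + card (B' \<inter> ((C - A) \<union> Z))" if "A \<subseteq> C" for C
    proof -
      have "T \<inter> C = (T \<inter> A) \<union> (B' \<inter> (C - A))" using T(2) that by auto
      then have "card (T \<inter> C) = card (T \<inter> A) + card (B' \<inter> (C - A))"
        using fT fB by (auto intro!: card_Un_disjoint)
      moreover have "card (B' \<inter> ((C - A) \<union> Z)) = card (B' \<inter> (C - A)) + card (B' \<inter> Z)"
        unfolding Int_Un_distrib using fB ZA by (intro card_Un_disjoint) auto
      ultimately show ?thesis using T(3) by simp
    qed
    have "card T = r"
    proof -
      have "T \<inter> E = T" "B' \<inter> ((E - A) \<union> Z) = B'" using T(1) indep_subset_ground B'E by auto
      then show ?thesis using card_split[OF AE] B'(2) rm by simp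
    qed
    moreover have "k * card (T \<inter> C) < sum w C + k \<and> sum w C < k * card (T \<inter> C) + k"
      if C: "C \<in> \<A>" for C
    proof (cases "C = A")
      case True
      have "card (B' \<inter> Z) = 0 \<or> card (B' \<inter> Z) = 1 \<and> s > 0"
        unfolding Z_def by (cases "z \<in> B'") auto
      then show ?thesis using T(3) wA s True by (auto simp: algebra_simps)
    next
      case False
      have CE: "C \<subseteq> E" using C less.prems(5) by blast
      have f: "k * card (B' \<inter> f C) < sum w' (f C) + k \<and> sum w' (f C) < k * card (B' \<inter> f C) + k"
        using B'f C False by blast
      show ?thesis
      proof (cases "A \<subseteq> C")
        case True
        then show ?thesis
          using f weight[OF True CE] card_split[OF True] unfolding f_def by (simp add: algebra_simps)
      next
        case False
        then have d: "C \<inter> A = {}" using cases[OF C] by blast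
        then have "f C = C" "C - A = C" using False unfolding f_def by auto
        moreover have "T \<inter> C = B' \<inter> C" using d T(2) by blast
        ultimately show ?thesis using f sum_w'[of C] by simp
      qed
    qed
    ultimately show ?thesis using T(1) by blast
  qed
qed

lemma (in matroid) balanced_base:
  assumes "k > 0"
    and "D \<subseteq> E" "\<forall>e\<in>D. \<not> multi_spanned D \<I> (k + 1) e" "card D = k * matroid_rank \<I> D"
    and "laminar_family \<A>"
  obtains B where "B \<in> \<I>" "B \<subseteq> D" "card B = matroid_rank \<I> D"
    "\<And>A. A \<in> \<A> \<Longrightarrow> k * card (B \<inter> A) < card (D \<inter> A) + k \<and> card (D \<inter> A) < k * card (B \<inter> A) + k"
proof -
  have "laminar_family ((\<inter>) D ` \<A>)"
    using assms(5) unfolding laminar_family_def by (simp; blast)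
  moreover have "\<exists>Y\<in>{Y \<in> \<I>. Y \<subseteq> D}. Y \<subseteq> X \<and> (\<Sum>x\<in>X. 1) \<le> k * card Y" if "X \<subseteq> D" for X
  proof -
    have "\<forall>e\<in>X. \<not> multi_spanned X \<I> (k + 1) e"
      using assms(3) that multi_spanned_mono by (metis subsetD)
    then have "card X \<le> k * matroid_rank \<I> X"
      using card_le_mult_rank that assms(2) by (meson subset_trans)
    then show ?thesis using that obtain_base[of X]
      by (smt (verit) card_eq_sum dual_order.trans mem_Collect_eq)
  qed
  ultimately obtain B where B: "B \<in> \<I>" "B \<subseteq> D" "card B = matroid_rank \<I> D"
    "\<forall>A\<in>(\<inter>) D ` \<A>. k * card (B \<inter> A) < (\<Sum>x\<in>A. 1) + k \<and> (\<Sum>x\<in>A. 1) < k * card (B \<inter> A) + k"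
    using balanced_base_weighted[OF matroid_restrict[OF assms(2)] assms(1), of "\<lambda>_. 1"
        "matroid_rank \<I> D" "(\<inter>) D ` \<A>"] assms(4)
    by auto
  have "B \<inter> (D \<inter> A) = B \<inter> A" for A using B(2) by blast
  then show thesis using that B by simp
qed


section \<open>Partitioning into common independent sets\<close>

lemma partition_insert:
  assumes "partition_into k (D - B) X" "B \<subseteq> D"
  shows "partition_into (Suc k) D (X(Suc k := B))"
proof -
  have P: "X i \<subseteq> D - B" if "i \<in> {1..k}" for i
    using assms(1) that unfolding partition_into_def by blast
  have dj: "X i \<inter> X j = {}" if "i \<in> {1..k}" "j \<in> {1..k}" "i \<noteq> j" for i j
    using assms(1) that unfolding partition_into_def disjoint_family_on_def by blast
  have I: "{1..Suc k} = insert (Suc k) {1..k}" by auto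
  have "disjoint_family_on (X(Suc k := B)) {1..Suc k}"
    unfolding I disjoint_family_on_def using dj P by (auto; fastforce)
  moreover have "(\<Union>j\<in>{1..Suc k}. (X(Suc k := B)) j) = B \<union> (\<Union>j\<in>{1..k}. X j)"
    unfolding I by auto
  then have "(\<Union>j\<in>{1..Suc k}. (X(Suc k := B)) j) = D"
    using assms unfolding partition_into_def by auto
  ultimately show ?thesis unfolding partition_into_def by blast
qed

text \<open>Here \<open>n = |D \<inter> A|\<close> and \<open>b = |B \<inter> A|\<close>. A rounded value of \<open>n / (k + 1) \<le> q\<close> is at most \<open>q\<close>. If it
  is smaller than \<open>q\<close>, then \<open>n \<le> (k + 1) b + k\<close> gives \<open>n - b \<le> k (b + 1) \<le> k q\<close>.\<close>

lemma balanced_bounds: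
  fixes k n b q :: nat
  assumes "n \<le> Suc k * q" "Suc k * b < n + Suc k" "n < Suc k * b + Suc k"
  shows "b \<le> q" "n - b \<le> k * q"
proof -
  have "Suc k * b < Suc k * Suc q" using assms by simp
  then show "b \<le> q" by (metis less_Suc_eq_le mult_less_cancel1)
  show "n - b \<le> k * q"
  proof (cases "b = q")
    case False
    then have "Suc b \<le> q" using \<open>b \<le> q\<close> by simp
    then have "k * Suc b \<le> k * q" by (rule mult_le_mono2)
    then show ?thesis using assms by simp
  qed (use assms in simp)
qed

text \<open>The rank of \<open>D - B\<close> does not drop while \<open>k > 0\<close>: \<open>D - B\<close> has \<open>k r(D)\<close> elements, and by
  \<open>card_le_mult_rank\<close> at most \<open>k r(D - B)\<close>. So the hypotheses pass from \<open>k + 1\<close> to \<open>k\<close>.\<close>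

lemma (in matroid) partition_into_laminar_bases:
  assumes "laminar_family \<A>"
    and "D \<subseteq> E" "\<forall>e\<in>D. \<not> multi_spanned D \<I> (k + 1) e" "card D = k * matroid_rank \<I> D"
    and "\<forall>A\<in>\<A>. card (D \<inter> A) \<le> k * q A"
  shows "\<exists>X. partition_into k D X \<and>
    (\<forall>j\<in>{1..k}. X j \<in> \<I> \<and> (\<forall>A\<in>\<A>. card (X j \<inter> A) \<le> q A))"
  using assms(2-)
proof (induction k arbitrary: D)
  case 0
  then have "D = {}" using finite_ground finite_subset by (metis card_0_eq mult_0)
  then show ?case unfolding partition_into_def disjoint_family_on_def by auto
next
  case (Suc k)
  have fD: "finite D" using Suc.prems(1) finite_ground finite_subset by blast
  obtain B where B: "B \<in> \<I>" "B \<subseteq> D" "card B = matroid_rank \<I> D"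
    and bal: "\<And>A. A \<in> \<A> \<Longrightarrow> Suc k * card (B \<inter> A) < card (D \<inter> A) + Suc k \<and>
        card (D \<inter> A) < Suc k * card (B \<inter> A) + Suc k"
    using balanced_base[OF _ Suc.prems(1-3) assms(1)] by blast
  have D': "D - B \<subseteq> E" using Suc.prems(1) by blast
  have unspanned: "\<forall>e\<in>D - B. \<not> multi_spanned (D - B) \<I> (k + 1) e"
    using Suc.prems(2) multi_spanned_remove_base[OF B] by auto
  have c: "card (D - B) = k * matroid_rank \<I> D"
    using B fD Suc.prems(3) by (simp add: card_Diff_subset finite_subset)
  have "card (D - B) = k * matroid_rank \<I> (D - B)"
  proof (rule antisym)
    show "card (D - B) \<le> k * matroid_rank \<I> (D - B)"
      using card_le_mult_rank[OF D' unspanned] .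
    show "k * matroid_rank \<I> (D - B) \<le> card (D - B)"
      unfolding c by (intro mult_le_mono2 rank_mono) auto
  qed
  moreover have cap: "card (B \<inter> A) \<le> q A \<and> card ((D - B) \<inter> A) \<le> k * q A" if "A \<in> \<A>" for A
  proof -
    have "(D - B) \<inter> A = (D \<inter> A) - (B \<inter> A)" by blast
    then have "card ((D - B) \<inter> A) = card (D \<inter> A) - card (B \<inter> A)"
      using B(2) fD card_Diff_subset[of "B \<inter> A" "D \<inter> A"]
      by (metis Int_mono finite_Int finite_subset order_refl)
    then show ?thesis using balanced_bounds[of "card (D \<inter> A)" k "q A"] bal that Suc.prems(4) by simp
  qed
  ultimately obtain X where X: "partition_into k (D - B) X"
    "\<forall>j\<in>{1..k}. X j \<in> \<I> \<and> (\<forall>A\<in>\<A>. card (X j \<inter> A) \<le> q A)"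
    using Suc.IH[OF D' unspanned] by blast
  have "\<forall>j\<in>{1..Suc k}. (X(Suc k := B)) j \<in> \<I> \<and> (\<forall>A\<in>\<A>. card ((X(Suc k := B)) j \<inter> A) \<le> q A)"
    using X(2) B(1) cap by (auto simp: le_Suc_eq)
  then show ?case using partition_insert[OF X(1) B(2)] by blast
qed

theorem theorem3p15:
  fixes E :: "'a set" and \<I>\<^sub>1 \<I>\<^sub>2 :: "'a set set" and k :: nat
  assumes "k > 0"
    and "laminar_matroid E \<I>\<^sub>1"
    and "E \<in> union_power E \<I>\<^sub>1 k"
    and "matroid E \<I>\<^sub>2"
    and "card E = k * matroid_rank \<I>\<^sub>2 E"
    and "\<forall>e\<in>E. \<not> multi_spanned E \<I>\<^sub>2 (k + 1) e"
  shows "\<exists>X. partition_into k E X \<and> (\<forall>j\<in>{1..k}. X j \<in> \<I>\<^sub>1 \<inter> \<I>\<^sub>2)"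
proof -
  interpret M2: matroid E \<I>\<^sub>2 by fact
  obtain \<A> and q :: "'a set \<Rightarrow> nat" where lam: "laminar_family \<A>"
    and I1: "\<I>\<^sub>1 = {X. X \<subseteq> E \<and> (\<forall>A\<in>\<A>. card (X \<inter> A) \<le> q A)}"
    using assms(2) unfolding laminar_matroid_def by blast
  obtain P where P: "(\<Union>j\<in>{1..k}. P j) = E" "\<forall>j\<in>{1..k}. P j \<in> \<I>\<^sub>1"
    using assms(3) unfolding union_power_def partition_into_def by blast
  have "card (E \<inter> A) \<le> k * q A" if "A \<in> \<A>" for A
  proof -
    have "E \<inter> A = (\<Union>j\<in>{1..k}. P j \<inter> A)" using P(1) by blast
    then have "card (E \<inter> A) \<le> (\<Sum>j\<in>{1..k}. card (P j \<inter> A))"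
      using card_UN_le[of "{1..k}" "\<lambda>j. P j \<inter> A"] by (metis finite_atLeastAtMost)
    also have "\<dots> \<le> (\<Sum>j\<in>{1..k}. q A)" using P(2) that I1 by (intro sum_mono) auto
    finally show ?thesis by simp
  qed
  then obtain X where X: "partition_into k E X"
    "\<forall>j\<in>{1..k}. X j \<in> \<I>\<^sub>2 \<and> (\<forall>A\<in>\<A>. card (X j \<inter> A) \<le> q A)"
    using M2.partition_into_laminar_bases[OF lam order_refl assms(6,5)] by blast
  then show ?thesis using I1 M2.indep_subset_ground by blast
qed

end
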